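(* Let $M$ be a differentiable manifold, $U\subset M$ a subset, and $D$ an $S$-derivation of the tensor algebra over $M$. If there exists a basis $\{E_{i'}\}$ of vector fields, defined in a neighborhood of $U$, in which the component matrix $W'_X$ of $D$ satisfies $W'_X|_U=0$ for every vector field $X$, then $D$ is a linear connection on the set $U$.
   Context: $M$ is a real differentiable manifold, $n=\dim M$; repeated Latin indices are summed from $1$ to $n$. Let $S: X\mapsto S_X$ be a fixed map (no linearity in $X$ is assumed) from the set of $C^1$ vector fields on $M$ to tensor fields of type $(1,1)$, each $S_X$ being regarded as a derivation of the tensor algebra. The $S$-derivation $D$ is the map $X\mapsto D_X:=L_X+S_X$, where $L_X$ is the Lie derivative along $X$ (so on vector fields $D_XY=[X,Y]+S_X(Y)$). For a local basis (frame) $\{E_i\}_{i=1}^n$ of vector fields (holonomic or not), the components $(W_X)^i_{\ j}$ of $D$ along $X$ are defined by $D_X(E_j)=(W_X)^i_{\ j}E_i$, and $W_X:=[(W_X)^i_{\ j}]$ (superscript = first matrix index). $W'_X$ denotes the component matrix in the basis $\{E_{i'}\}$. $D$ is called a linear connection on the set $U\subset M$ if in some, and hence in any, basis $\{E_i\}$ one has $W_X(x)=\Gamma_k(x)X^k(x)$ for all $x\in U$ and every vector field $X=X^kE_k$, where $\Gamma_k$ ($k=1,\dots,n$) are some matrix-valued functions on $U$ (not depending on $X$). *)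

theory Defs
  imports "HOL-Analysis.Analysis"
begin

definition C1_on :: "('b::real_normed_vector \<Rightarrow> 'c::real_normed_vector) \<Rightarrow> 'b set \<Rightarrow> bool" where
  "C1_on f W \<longleftrightarrow>
     (\<exists>f' :: 'b \<Rightarrow> 'b \<Rightarrow>\<^sub>L 'c.
        (\<forall>u\<in>W. (f has_derivative blinfun_apply (f' u)) (at u)) \<and> continuous_on W f')"

definition C2_on :: "('b::real_normed_vector \<Rightarrow> 'c::real_normed_vector) \<Rightarrow> 'b set \<Rightarrow> bool" where
  "C2_on f W \<longleftrightarrow>
     (\<exists>f' :: 'b \<Rightarrow> 'b \<Rightarrow>\<^sub>L 'c.
        (\<forall>u\<in>W. (f has_derivative blinfun_apply (f' u)) (at u)) \<and> C1_on f' W)"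

text \<open>A chart is a pair of its domain and its coordinate map (whose values outside the domain
  are irrelevant). The dimension of the manifold is the cardinality of the index type.\<close>

type_synonym ('a, 'n) chart = "'a set \<times> ('a \<Rightarrow> real ^ 'n)"

abbreviation chart_dom :: "('a, 'n) chart \<Rightarrow> 'a set" where
  "chart_dom \<equiv> fst"

abbreviation chart_map :: "('a, 'n) chart \<Rightarrow> 'a \<Rightarrow> real ^ 'n" where
  "chart_map \<equiv> snd"

abbreviation chart_inv :: "('a, 'n) chart \<Rightarrow> real ^ 'n \<Rightarrow> 'a" where
  "chart_inv c \<equiv> inv_into (chart_dom c) (chart_map c)"

definition is_chart :: "'a topology \<Rightarrow> ('a, 'n::finite) chart \<Rightarrow> bool" where
  "is_chart M c \<longleftrightarrow>
     openin M (chart_dom c) \<and>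
     open (chart_map c ` chart_dom c) \<and>
     homeomorphic_map (subtopology M (chart_dom c)) (top_of_set (chart_map c ` chart_dom c))
       (chart_map c)"

definition transition ::
  "('a, 'n::finite) chart \<Rightarrow> ('a, 'n) chart \<Rightarrow> real ^ 'n \<Rightarrow> real ^ 'n" where
  "transition c d = chart_map d \<circ> chart_inv c"

text \<open>Class \<open>C\<^sup>2\<close> is the least regularity for which \<open>C\<^sup>1\<close> vector fields make sense. Every atlas of
  class \<open>C\<^sup>k\<close> with \<open>2 \<le> k \<le> \<infinity>\<close>, maximal or not, is admitted.\<close>

definition differentiable_manifold :: "'a topology \<Rightarrow> ('a, 'n::finite) chart set \<Rightarrow> bool" where
  "differentiable_manifold M A \<longleftrightarrow>
     Hausdorff_space M \<and>
     (\<forall>c\<in>A. is_chart M c) \<and>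
     (\<Union>c\<in>A. chart_dom c) = topspace M \<and>
     (\<forall>c\<in>A. \<forall>d\<in>A. C2_on (transition c d) (chart_map c ` (chart_dom c \<inter> chart_dom d)))"

text \<open>A tangent vector at \<open>p\<close> is the family of its coordinate columns in all charts of the atlas
  around \<open>p\<close>, any two of them related by the Jacobian of the change of coordinates. For all other
  charts the entry is set to zero, so that equality of tangent vectors is equality of functions;
  the vector space operations are pointwise.\<close>

type_synonym ('a, 'n) tangent = "('a, 'n) chart \<Rightarrow> real ^ 'n"

definition tangent_space ::
  "('a, 'n::finite) chart set \<Rightarrow> 'a \<Rightarrow> ('a, 'n) tangent set" where
  "tangent_space A p =
     {v. (\<forall>c\<in>A. \<forall>d\<in>A. p \<in> chart_dom c \<inter> chart_dom d \<longrightarrow>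
            v d = frechet_derivative (transition c d) (at (chart_map c p)) (v c)) \<and>
         (\<forall>c. \<not> (c \<in> A \<and> p \<in> chart_dom c) \<longrightarrow> v c = 0)}"

definition lincomb ::
  "real ^ 'n::finite \<Rightarrow> ('n \<Rightarrow> ('a, 'n) tangent) \<Rightarrow> ('a, 'n) tangent" where
  "lincomb a e = (\<lambda>c. \<Sum>i\<in>UNIV. (a $ i) *\<^sub>R e i c)"

type_synonym ('a, 'n) vfield = "'a \<Rightarrow> ('a, 'n) tangent"

definition local_rep ::
  "('a, 'n::finite) chart \<Rightarrow> ('a, 'n) vfield \<Rightarrow> real ^ 'n \<Rightarrow> real ^ 'n" where
  "local_rep c X = (\<lambda>u. X (chart_inv c u) c)"

definition C1_field_on ::
  "('a, 'n::finite) chart set \<Rightarrow> 'a set \<Rightarrow> ('a, 'n) vfield \<Rightarrow> bool" where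
  "C1_field_on A V X \<longleftrightarrow>
     (\<forall>p\<in>V. X p \<in> tangent_space A p) \<and>
     (\<forall>c\<in>A. C1_on (local_rep c X) (chart_map c ` (chart_dom c \<inter> V)))"

definition C1_fields ::
  "'a topology \<Rightarrow> ('a, 'n::finite) chart set \<Rightarrow> ('a, 'n) vfield set" where
  "C1_fields M A = {X \<in> extensional (topspace M). C1_field_on A (topspace M) X}"

text \<open>In each chart, \<open>[X, Y]\<^sup>i = X\<^sup>k \<partial>\<^sub>k Y\<^sup>i - Y\<^sup>k \<partial>\<^sub>k X\<^sup>i\<close>.\<close>

definition lie_bracket ::
  "('a, 'n::finite) chart set \<Rightarrow> ('a, 'n) vfield \<Rightarrow> ('a, 'n) vfield \<Rightarrow> ('a, 'n) vfield" where
  "lie_bracket A X Y = (\<lambda>p c.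
     if c \<in> A \<and> p \<in> chart_dom c
     then frechet_derivative (local_rep c Y) (at (chart_map c p)) (X p c)
        - frechet_derivative (local_rep c X) (at (chart_map c p)) (Y p c)
     else 0)"

text \<open>Tensor fields of type (1,1) as fields of endomorphisms of the tangent spaces; no regularity
  in the base point is imposed.\<close>

definition tensor_field_11 ::
  "'a topology \<Rightarrow> ('a, 'n::finite) chart set \<Rightarrow> ('a \<Rightarrow> ('a, 'n) tangent \<Rightarrow> ('a, 'n) tangent) \<Rightarrow> bool"
  where
  "tensor_field_11 M A T \<longleftrightarrow>
     (\<forall>p\<in>topspace M.
        (\<forall>v\<in>tangent_space A p. T p v \<in> tangent_space A p) \<and>
        (\<forall>v\<in>tangent_space A p. \<forall>w\<in>tangent_space A p. \<forall>a b.
           T p (\<lambda>c. a *\<^sub>R v c + b *\<^sub>R w c) = (\<lambda>c. a *\<^sub>R T p v c + b *\<^sub>R T p w c)))"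

text \<open>The action of \<open>D\<^sub>X = L\<^sub>X + S\<^sub>X\<close> on a vector field \<open>Y\<close>, which may be defined only on an open set.
  As a derivation of the tensor algebra, \<open>D\<^sub>X\<close> is determined by this action together with
  \<open>D\<^sub>X f = X f\<close> on functions.\<close>

definition S_derivation ::
  "('a, 'n::finite) chart set \<Rightarrow>
   (('a, 'n) vfield \<Rightarrow> 'a \<Rightarrow> ('a, 'n) tangent \<Rightarrow> ('a, 'n) tangent) \<Rightarrow>
   ('a, 'n) vfield \<Rightarrow> ('a, 'n) vfield \<Rightarrow> ('a, 'n) vfield" where
  "S_derivation A S X Y = (\<lambda>p c. lie_bracket A X Y p c + S X p (Y p) c)"

definition is_S_derivation ::
  "'a topology \<Rightarrow> ('a, 'n::finite) chart set \<Rightarrow>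
   (('a, 'n) vfield \<Rightarrow> ('a, 'n) vfield \<Rightarrow> ('a, 'n) vfield) \<Rightarrow> bool" where
  "is_S_derivation M A D \<longleftrightarrow>
     (\<exists>S. (\<forall>X\<in>C1_fields M A. tensor_field_11 M A (S X)) \<and> D = S_derivation A S)"

definition C1_frame_on ::
  "('a, 'n::finite) chart set \<Rightarrow> 'a set \<Rightarrow> ('n \<Rightarrow> ('a, 'n) vfield) \<Rightarrow> bool" where
  "C1_frame_on A V E \<longleftrightarrow>
     (\<forall>i. C1_field_on A V (E i)) \<and>
     (\<forall>p\<in>V. \<forall>v\<in>tangent_space A p. \<exists>!a. v = lincomb a (\<lambda>i. E i p))"

text \<open>Frames defined in a neighbourhood of an arbitrary set \<open>U\<close>.\<close>

definition C1_frame_near ::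
  "'a topology \<Rightarrow> ('a, 'n::finite) chart set \<Rightarrow> 'a set \<Rightarrow> ('n \<Rightarrow> ('a, 'n) vfield) \<Rightarrow> bool" where
  "C1_frame_near M A U E \<longleftrightarrow> (\<exists>V. openin M V \<and> U \<subseteq> V \<and> C1_frame_on A V E)"

definition coords ::
  "('n::finite \<Rightarrow> ('a, 'n) vfield) \<Rightarrow> 'a \<Rightarrow> ('a, 'n) tangent \<Rightarrow> real ^ 'n" where
  "coords E p v = (THE a. v = lincomb a (\<lambda>i. E i p))"

text \<open>\<open>W\<close> is the component matrix of \<open>D\<close> along \<open>X\<close> at \<open>p\<close>, i.e. \<open>(D\<^sub>X E\<^sub>j)(p) = W\<^sup>i\<^sub>j E\<^sub>i(p)\<close>. Given a
  frame \<open>E\<close>, there is exactly one such matrix; the upper index is the row index \<open>W $ i $ j\<close>.\<close>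

definition component_matrix ::
  "(('a, 'n::finite) vfield \<Rightarrow> ('a, 'n) vfield \<Rightarrow> ('a, 'n) vfield) \<Rightarrow>
   ('n \<Rightarrow> ('a, 'n) vfield) \<Rightarrow> ('a, 'n) vfield \<Rightarrow> 'a \<Rightarrow> real ^ 'n ^ 'n \<Rightarrow> bool" where
  "component_matrix D E X p W \<longleftrightarrow>
     (\<forall>j. D X (E j) p = lincomb (\<chi> i. W $ i $ j) (\<lambda>i. E i p))"

definition linear_in_frame ::
  "'a topology \<Rightarrow> ('a, 'n::finite) chart set \<Rightarrow>
   (('a, 'n) vfield \<Rightarrow> ('a, 'n) vfield \<Rightarrow> ('a, 'n) vfield) \<Rightarrow>
   'a set \<Rightarrow> ('n \<Rightarrow> ('a, 'n) vfield) \<Rightarrow> bool" where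
  "linear_in_frame M A D U E \<longleftrightarrow>
     (\<exists>\<Gamma> :: 'n \<Rightarrow> 'a \<Rightarrow> real ^ 'n ^ 'n.
        \<forall>X\<in>C1_fields M A. \<forall>x\<in>U.
          component_matrix D E X x (\<Sum>k\<in>UNIV. (coords E x (X x) $ k) *\<^sub>R \<Gamma> k x))"

text \<open>The defining condition is required in some frame and also in every frame near \<open>U\<close>, so that
  its independence of the frame is part of the notion and not taken for granted.\<close>

definition linear_connection_on ::
  "'a topology \<Rightarrow> ('a, 'n::finite) chart set \<Rightarrow>
   (('a, 'n) vfield \<Rightarrow> ('a, 'n) vfield \<Rightarrow> ('a, 'n) vfield) \<Rightarrow> 'a set \<Rightarrow> bool" where
  "linear_connection_on M A D U \<longleftrightarrow>
     (\<exists>E. C1_frame_near M A U E \<and> linear_in_frame M A D U E) \<and>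
     (\<forall>E. C1_frame_near M A U E \<longrightarrow> linear_in_frame M A D U E)"

end

theory Submission
  imports Defs
begin

text \<open>
  Fix a point \<open>x \<in> U\<close>, let \<open>E'\<close> be the frame along which all components of \<open>D\<close> vanish on \<open>U\<close>, and
  let \<open>E\<close> be any frame near \<open>U\<close>. The classical argument writes \<open>E\<^sub>j = a\<^sup>i\<^sub>j E'\<^sub>i\<close> with coefficient
  functions and obtains \<open>D\<^sub>X E\<^sub>j = X(a\<^sup>i\<^sub>j) E'\<^sub>i\<close>, which depends linearly on the value of \<open>X\<close> at the point.

  The proof below uses only the values of the \<open>a\<^sup>i\<^sub>j\<close> at \<open>x\<close>, so that they are never differentiated
  and no inverse of a matrix of functions occurs. With the constants \<open>a\<^sup>i = a\<^sup>i\<^sub>j(x)\<close>, the field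
  \<open>Z = E\<^sub>j - a\<^sup>i E'\<^sub>i\<close> vanishes at \<open>x\<close>. Since \<open>D\<^sub>X\<close> is additive and commutes with constant factors, and
  \<open>D\<^sub>X E'\<^sub>i\<close> vanishes at \<open>x\<close>, the vector \<open>(D\<^sub>X E\<^sub>j)(x)\<close> equals \<open>(D\<^sub>X Z)(x)\<close>
  (\<open>S_derivation_parallel_comb\<close>). Now both \<open>S\<^sub>X(Z)\<close> and the term \<open>Z\<^sup>k \<partial>\<^sub>k X\<^sup>i\<close> of the bracket drop out at
  the zero \<open>x\<close> of \<open>Z\<close>, leaving \<open>X\<^sup>k \<partial>\<^sub>k Z\<^sup>i\<close> (\<open>S_derivation_at_zero\<close>). Partial derivatives of
  components are not a tensor in general, but at a zero of \<open>Z\<close> the second derivatives of the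
  coordinate changes are multiplied by \<open>0\<close>, so that \<open>v \<mapsto> v\<^sup>k \<partial>\<^sub>k Z\<^sup>i\<close> is a linear endomorphism of the
  tangent space at \<open>x\<close> that does not depend on \<open>X\<close> (\<open>coord_deriv_tangent\<close>). Its values on the
  vectors \<open>E\<^sub>k(x)\<close>, expanded in the basis \<open>E\<^sub>i(x)\<close>, give the \<open>j\<close>-th column of \<open>\<Gamma>\<^sub>k(x)\<close>.
\<close>

section \<open>Charts and differentiability of fields\<close>

lemma chart_inv_chart_map:
  assumes "is_chart M c" "p \<in> chart_dom c"
  shows "chart_inv c (chart_map c p) = p"
proof -
  have "chart_dom c \<subseteq> topspace M"
    using assms(1) openin_subset unfolding is_chart_def by blast
  hence "inj_on (chart_map c) (chart_dom c)"
    using assms(1) unfolding is_chart_def homeomorphic_eq_everything_map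
    by (simp add: Int_absorb1)
  thus ?thesis using assms(2) by simp
qed

lemma open_chart_image:
  assumes "is_chart M c" "openin M V"
  shows "open (chart_map c ` (chart_dom c \<inter> V))"
proof -
  have "openin (subtopology M (chart_dom c)) (chart_dom c \<inter> V)"
    using assms(2) by (rule openin_subtopology_Int2)
  moreover have "open_map (subtopology M (chart_dom c)) (top_of_set (chart_map c ` chart_dom c))
      (chart_map c)"
    using assms(1) unfolding is_chart_def homeomorphic_eq_everything_map by blast
  ultimately have "openin (top_of_set (chart_map c ` chart_dom c)) (chart_map c ` (chart_dom c \<inter> V))"
    unfolding open_map_def by blast
  thus ?thesis
    using assms(1) openin_open_trans unfolding is_chart_def by blast
qed

lemma C1_on_differentiable: "C1_on f W \<Longrightarrow> u \<in> W \<Longrightarrow> f differentiable at u"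
  unfolding C1_on_def differentiable_def by blast

lemma C1_field_differentiable:
  assumes "C1_field_on A V X" "c \<in> A" "p \<in> chart_dom c" "p \<in> V"
  shows "local_rep c X differentiable at (chart_map c p)"
  using assms C1_on_differentiable unfolding C1_field_on_def by blast

lemma field_differentiable:
  assumes "X \<in> C1_fields M A" "c \<in> A" "p \<in> chart_dom c" "p \<in> topspace M"
  shows "local_rep c X differentiable at (chart_map c p)"
proof -
  have "C1_field_on A (topspace M) X" using assms(1) unfolding C1_fields_def by simp
  thus ?thesis using assms(2-4) by (rule C1_field_differentiable)
qed

lemma manifold_chart: "differentiable_manifold M A \<Longrightarrow> c \<in> A \<Longrightarrow> is_chart M c"
  unfolding differentiable_manifold_def by blast

lemma transition_derivative:
  assumes "differentiable_manifold M A" "c \<in> A" "d \<in> A"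
  obtains J :: "real ^ 'n::finite \<Rightarrow> (real ^ 'n) \<Rightarrow>\<^sub>L (real ^ 'n)"
  where "\<And>p. p \<in> chart_dom c \<inter> chart_dom d \<Longrightarrow>
           (transition c d has_derivative blinfun_apply (J (chart_map c p))) (at (chart_map c p))"
    and "\<And>p. p \<in> chart_dom c \<inter> chart_dom d \<Longrightarrow> J differentiable at (chart_map c p)"
proof -
  have "C2_on (transition c d) (chart_map c ` (chart_dom c \<inter> chart_dom d))"
    using assms unfolding differentiable_manifold_def by blast
  then obtain J where J: "\<forall>u\<in>chart_map c ` (chart_dom c \<inter> chart_dom d).
        (transition c d has_derivative blinfun_apply (J u)) (at u)"
      "C1_on J (chart_map c ` (chart_dom c \<inter> chart_dom d))"
    unfolding C2_on_def by blast
  show thesis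
    using J(1) C1_on_differentiable[OF J(2)] by (intro that[of J]) blast+
qed

section \<open>Linear structure of the tangent spaces\<close>

lemma tangent_space_change:
  "\<lbrakk>v \<in> tangent_space A p; c \<in> A; d \<in> A; p \<in> chart_dom c; p \<in> chart_dom d\<rbrakk> \<Longrightarrow>
     v d = frechet_derivative (transition c d) (at (chart_map c p)) (v c)"
  unfolding tangent_space_def by blast

lemma tangent_space_outside:
  "v \<in> tangent_space A p \<Longrightarrow> \<not> (c \<in> A \<and> p \<in> chart_dom c) \<Longrightarrow> v c = 0"
  unfolding tangent_space_def by blast

lemma linear_transition_derivative:
  assumes "differentiable_manifold M A" "c \<in> A" "d \<in> A" "p \<in> chart_dom c" "p \<in> chart_dom d"
  shows "linear (frechet_derivative (transition c d) (at (chart_map c p)))"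
proof -
  obtain J where "(transition c d has_derivative blinfun_apply (J (chart_map c p)))
      (at (chart_map c p))"
    using transition_derivative[OF assms(1-3)] assms(4,5) by blast
  thus ?thesis
    by (intro linear_frechet_derivative) (auto simp: differentiable_def)
qed

lemma tangent_space_comb:
  assumes "differentiable_manifold M A" "v \<in> tangent_space A p" "w \<in> tangent_space A p"
  shows "(\<lambda>c. a *\<^sub>R v c + b *\<^sub>R w c) \<in> tangent_space A p"
proof -
  have "a *\<^sub>R v d + b *\<^sub>R w d =
      frechet_derivative (transition c d) (at (chart_map c p)) (a *\<^sub>R v c + b *\<^sub>R w c)"
    if "c \<in> A" "d \<in> A" "p \<in> chart_dom c" "p \<in> chart_dom d" for c d
    using linear_transition_derivative[OF assms(1) that]
      tangent_space_change[OF assms(2) that] tangent_space_change[OF assms(3) that]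
    by (simp add: linear_add linear_scale)
  moreover have "a *\<^sub>R v c + b *\<^sub>R w c = 0" if "\<not> (c \<in> A \<and> p \<in> chart_dom c)" for c
    using that tangent_space_outside[OF assms(2)] tangent_space_outside[OF assms(3)] by simp
  ultimately show ?thesis
    unfolding tangent_space_def by blast
qed

lemma tangent_space_zero:
  assumes "differentiable_manifold M A"
  shows "(\<lambda>c. 0) \<in> tangent_space A p"
  using linear_transition_derivative[OF assms] unfolding tangent_space_def
  by (auto simp: linear_0)

lemma tensor_field_comb:
  "\<lbrakk>tensor_field_11 M A T; p \<in> topspace M; v \<in> tangent_space A p; w \<in> tangent_space A p\<rbrakk> \<Longrightarrow>
     T p (\<lambda>c. a *\<^sub>R v c + b *\<^sub>R w c) = (\<lambda>c. a *\<^sub>R T p v c + b *\<^sub>R T p w c)"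
  unfolding tensor_field_11_def by blast

text \<open>Linearity of a tensor is available on the tangent space only, so the induction must carry
  along the membership of the partial sums in that space.\<close>

lemma tensor_field_sum:
  fixes A :: "('a, 'n::finite) chart set"
  assumes M: "differentiable_manifold M A" and T: "tensor_field_11 M A T" and p: "p \<in> topspace M"
    and e: "\<And>i. e i \<in> tangent_space A p" and fin: "finite I"
  shows "(\<lambda>c. \<Sum>i\<in>I. a i *\<^sub>R e i c) \<in> tangent_space A p \<and>
         T p (\<lambda>c. \<Sum>i\<in>I. a i *\<^sub>R e i c) = (\<lambda>c. \<Sum>i\<in>I. a i *\<^sub>R T p (e i) c)"
  using fin
proof (induction I rule: finite_induct)
  case empty
  have "T p (\<lambda>c. 0 *\<^sub>R (0 :: real ^ 'n) + 0 *\<^sub>R 0) =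
      (\<lambda>c. 0 *\<^sub>R T p (\<lambda>c. 0) c + 0 *\<^sub>R T p (\<lambda>c. 0) c)"
    using tensor_field_comb[OF T p tangent_space_zero[OF M] tangent_space_zero[OF M], of 0 0] .
  thus ?case using tangent_space_zero[OF M] by simp
next
  case (insert i I)
  let ?w = "\<lambda>c. \<Sum>i\<in>I. a i *\<^sub>R e i c"
  have w: "?w \<in> tangent_space A p" using insert by blast
  have "(\<lambda>c. a i *\<^sub>R e i c + 1 *\<^sub>R ?w c) \<in> tangent_space A p"
    using M e w by (rule tangent_space_comb)
  moreover have "T p (\<lambda>c. a i *\<^sub>R e i c + 1 *\<^sub>R ?w c) = (\<lambda>c. a i *\<^sub>R T p (e i) c + 1 *\<^sub>R T p ?w c)"
    using T p e w by (rule tensor_field_comb)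
  ultimately show ?case using insert by simp
qed

lemma lincomb_tangent:
  assumes "differentiable_manifold M A" "\<And>i. e i \<in> tangent_space A p" "p \<in> topspace M"
  shows "lincomb a e \<in> tangent_space A p"
proof -
  have "tensor_field_11 M A (\<lambda>p v. v)"
    unfolding tensor_field_11_def by blast
  thus ?thesis
    using tensor_field_sum[where e = e and a = "($) a", OF assms(1) _ assms(3,2) finite_class.finite_UNIV]
    unfolding lincomb_def by blast
qed

lemma tensor_field_lincomb:
  assumes "differentiable_manifold M A" "tensor_field_11 M A T" "p \<in> topspace M"
    and "\<And>i. e i \<in> tangent_space A p"
  shows "T p (lincomb a e) = lincomb a (\<lambda>i. T p (e i))"
  using tensor_field_sum[where e = e and a = "($) a", OF assms finite_class.finite_UNIV]
  unfolding lincomb_def by blast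

lemma lincomb_coords:
  assumes "C1_frame_on A V E" "p \<in> V" "v \<in> tangent_space A p"
  shows "v = lincomb (coords E p v) (\<lambda>i. E i p)"
proof -
  have "\<exists>!a. v = lincomb a (\<lambda>i. E i p)"
    using bspec[OF bspec[OF conjunct2[OF assms(1)[unfolded C1_frame_on_def]] assms(2)] assms(3)] .
  thus ?thesis unfolding coords_def by (rule theI')
qed

section \<open>Derivatives of the components of a field\<close>

text \<open>In a chart this is \<open>v\<^sup>k \<partial>\<^sub>k Z\<^sup>i\<close>, the derivative with respect to the flat connection of that
  chart. The results in different charts form a tangent vector only under additional assumptions
  such as those of \<open>coord_deriv_tangent\<close>.\<close>

definition coord_deriv ::
  "('a, 'n::finite) chart set \<Rightarrow> ('a, 'n) vfield \<Rightarrow> 'a \<Rightarrow> ('a, 'n) tangent \<Rightarrow> ('a, 'n) tangent" where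
  "coord_deriv A Z p v = (\<lambda>c.
     if c \<in> A \<and> p \<in> chart_dom c
     then frechet_derivative (local_rep c Z) (at (chart_map c p)) (v c) else 0)"

lemma lie_bracket_coord_deriv:
  "lie_bracket A X Y p = (\<lambda>c. coord_deriv A Y p (X p) c - coord_deriv A X p (Y p) c)"
  unfolding lie_bracket_def coord_deriv_def by auto

lemma coord_deriv_zero:
  assumes "\<And>c. c \<in> A \<Longrightarrow> p \<in> chart_dom c \<Longrightarrow> local_rep c Z differentiable at (chart_map c p)"
  shows "coord_deriv A Z p (\<lambda>c. 0) = (\<lambda>c. 0)"
  unfolding coord_deriv_def
  using linear_0[OF linear_frechet_derivative[OF assms]] by fastforce

lemma coord_deriv_lincomb:
  assumes "\<And>c. c \<in> A \<Longrightarrow> p \<in> chart_dom c \<Longrightarrow> local_rep c Z differentiable at (chart_map c p)"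
  shows "coord_deriv A Z p (lincomb a e) = lincomb a (\<lambda>k. coord_deriv A Z p (e k))"
proof
  fix c
  show "coord_deriv A Z p (lincomb a e) c = lincomb a (\<lambda>k. coord_deriv A Z p (e k)) c"
  proof (cases "c \<in> A \<and> p \<in> chart_dom c")
    case True
    hence "linear (frechet_derivative (local_rep c Z) (at (chart_map c p)))"
      using assms linear_frechet_derivative by blast
    thus ?thesis using True
      by (simp add: coord_deriv_def lincomb_def linear_sum linear_scale)
  qed (auto simp: coord_deriv_def lincomb_def)
qed

text \<open>Differentiate the transformation law \<open>Z\<^sup>d(\<phi>(u)) = J(u) Z\<^sup>c(u)\<close>, where \<open>\<phi>\<close> is the change of
  coordinates and \<open>J\<close> its Jacobian. The product rule yields a term with the derivative of \<open>J\<close>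
  applied to \<open>Z\<^sup>c\<close>; it vanishes where \<open>Z\<close> does, and what remains is the transformation law of a
  tangent vector.\<close>

lemma coord_deriv_tangent:
  fixes A :: "('a, 'n::finite) chart set"
  assumes M: "differentiable_manifold M A" and V: "openin M V" and p: "p \<in> V"
    and Z: "\<And>q. q \<in> V \<Longrightarrow> Z q \<in> tangent_space A q"
    and diff: "\<And>c. c \<in> A \<Longrightarrow> p \<in> chart_dom c \<Longrightarrow> local_rep c Z differentiable at (chart_map c p)"
    and zero: "Z p = (\<lambda>c. 0)"
    and v: "v \<in> tangent_space A p"
  shows "coord_deriv A Z p v \<in> tangent_space A p"
proof -
  have law: "frechet_derivative (local_rep d Z) (at (chart_map d p)) (v d) =
        frechet_derivative (transition c d) (at (chart_map c p))
          (frechet_derivative (local_rep c Z) (at (chart_map c p)) (v c))"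
    if cd: "c \<in> A" "d \<in> A" "p \<in> chart_dom c" "p \<in> chart_dom d" for c d
  proof -
    define u where "u = chart_map c p"
    have inv: "chart_inv c (chart_map c q) = q" if "q \<in> chart_dom c" for q
      using chart_inv_chart_map[OF manifold_chart[OF M cd(1)] that] .
    have inv': "chart_inv d (chart_map d q) = q" if "q \<in> chart_dom d" for q
      using chart_inv_chart_map[OF manifold_chart[OF M cd(2)] that] .
    obtain J :: "real ^ 'n \<Rightarrow> (real ^ 'n) \<Rightarrow>\<^sub>L (real ^ 'n)"
      where J: "\<And>q. q \<in> chart_dom c \<inter> chart_dom d \<Longrightarrow>
          (transition c d has_derivative blinfun_apply (J (chart_map c q))) (at (chart_map c q))"
        and J_diff: "\<And>q. q \<in> chart_dom c \<inter> chart_dom d \<Longrightarrow> J differentiable at (chart_map c q)"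
      using transition_derivative[OF M cd(1,2)] by blast
    define O' where "O' = chart_map c ` (chart_dom c \<inter> (chart_dom d \<inter> V))"
    have "openin M (chart_dom d)"
      using manifold_chart[OF M cd(2)] unfolding is_chart_def by blast
    hence open_O: "open O'"
      unfolding O'_def using manifold_chart[OF M cd(1)] V by (intro open_chart_image openin_Int)
    have u_O: "u \<in> O'" using cd p unfolding u_def O'_def by blast
    have fields: "local_rep d Z (transition c d w) = J w (local_rep c Z w)"
      if w: "w \<in> O'" for w
    proof -
      obtain q where q: "q \<in> chart_dom c" "q \<in> chart_dom d" "q \<in> V" "w = chart_map c q"
        using w unfolding O'_def by blast
      have "Z q d = frechet_derivative (transition c d) (at (chart_map c q)) (Z q c)"
        using tangent_space_change[OF Z[OF q(3)] cd(1,2) q(1,2)] .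
      also have "frechet_derivative (transition c d) (at (chart_map c q)) = J w"
        using frechet_derivative_at[OF J] q by simp
      finally show ?thesis
        using q inv inv' by (simp add: local_rep_def transition_def)
    qed
    have Jacobian: "(transition c d has_derivative blinfun_apply (J u)) (at u)"
      unfolding u_def using J cd by blast
    have Zu: "local_rep c Z u = 0"
      using inv[OF cd(3)] zero by (simp add: local_rep_def u_def)
    have image: "transition c d u = chart_map d p"
      using inv[OF cd(3)] by (simp add: transition_def u_def)
    obtain J' where J': "(J has_derivative J') (at u)"
      using J_diff cd unfolding u_def differentiable_def by blast
    let ?Zc = "frechet_derivative (local_rep c Z) (at u)"
    let ?Zd = "frechet_derivative (local_rep d Z) (at (transition c d u))"
    have Zc: "(local_rep c Z has_derivative ?Zc) (at u)"
      using diff cd unfolding u_def by (simp add: frechet_derivative_works[symmetric])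
    have "(local_rep d Z has_derivative ?Zd) (at (transition c d u))"
      using diff cd unfolding image by (simp add: frechet_derivative_works[symmetric])
    hence "((local_rep d Z \<circ> transition c d) has_derivative ?Zd \<circ> J u) (at u)"
      using diff_chain_at[OF Jacobian] by blast
    moreover have "((\<lambda>w. J w (local_rep c Z w)) has_derivative
        (\<lambda>h. J u (?Zc h) + J' h (local_rep c Z u))) (at u)"
      by (rule bounded_bilinear.FDERIV[OF bounded_bilinear_blinfun_apply J' Zc])
    hence "((\<lambda>w. J w (local_rep c Z w)) has_derivative (\<lambda>h. J u (?Zc h))) (at u)"
      by (simp add: Zu)
    hence "((local_rep d Z \<circ> transition c d) has_derivative (\<lambda>h. J u (?Zc h))) (at u)"
      using open_O u_O by (rule has_derivative_transform_within_open) (simp add: fields)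
    ultimately have "?Zd \<circ> J u = (\<lambda>h. J u (?Zc h))"
      by (rule has_derivative_unique)
    hence "?Zd (J u (v c)) = J u (?Zc (v c))"
      by (metis comp_apply)
    moreover have "frechet_derivative (transition c d) (at u) = J u"
      using frechet_derivative_at[OF Jacobian] by simp
    ultimately show ?thesis
      using tangent_space_change[OF v cd] image unfolding u_def by simp
  qed
  have "coord_deriv A Z p v d =
      frechet_derivative (transition c d) (at (chart_map c p)) (coord_deriv A Z p v c)"
    if "c \<in> A" "d \<in> A" "p \<in> chart_dom c" "p \<in> chart_dom d" for c d
    using law[OF that] that by (simp only: coord_deriv_def if_True simp_thms)
  moreover have "coord_deriv A Z p v c = 0" if "\<not> (c \<in> A \<and> p \<in> chart_dom c)" for c
    unfolding coord_deriv_def using that by (rule if_not_P)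
  ultimately show ?thesis
    unfolding tangent_space_def by blast
qed

section \<open>Fields minus combinations with constant coefficients\<close>

definition minus_comb ::
  "('a, 'n::finite) vfield \<Rightarrow> real ^ 'n \<Rightarrow> ('n \<Rightarrow> ('a, 'n) vfield) \<Rightarrow> ('a, 'n) vfield" where
  "minus_comb Y a F = (\<lambda>p c. Y p c - lincomb a (\<lambda>i. F i p) c)"

lemma local_rep_minus_comb:
  "local_rep c (minus_comb Y a F) =
     (\<lambda>u. local_rep c Y u - (\<Sum>i\<in>UNIV. (a $ i) *\<^sub>R local_rep c (F i) u))"
  by (simp add: local_rep_def minus_comb_def lincomb_def)

lemma minus_comb_differentiable:
  assumes "local_rep c Y differentiable at u" "\<And>i. local_rep c (F i) differentiable at u"
  shows "local_rep c (minus_comb Y a F) differentiable at u"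
  unfolding local_rep_minus_comb
  by (intro differentiable_diff differentiable_sum differentiable_scaleR differentiable_const
      assms finite_class.finite_UNIV ballI)

lemma minus_comb_tangent:
  assumes "differentiable_manifold M A" "p \<in> topspace M"
    and "Y p \<in> tangent_space A p" "\<And>i. F i p \<in> tangent_space A p"
  shows "minus_comb Y a F p \<in> tangent_space A p"
  using tangent_space_comb[OF assms(1,3) lincomb_tangent[OF assms(1,4,2)], of 1 "-1" a]
  by (simp add: minus_comb_def)

lemma coord_deriv_minus_comb:
  assumes "\<And>c. c \<in> A \<Longrightarrow> p \<in> chart_dom c \<Longrightarrow> local_rep c Y differentiable at (chart_map c p)"
    and "\<And>c i. c \<in> A \<Longrightarrow> p \<in> chart_dom c \<Longrightarrow> local_rep c (F i) differentiable at (chart_map c p)"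
  shows "coord_deriv A (minus_comb Y a F) p v =
     (\<lambda>c. coord_deriv A Y p v c - lincomb a (\<lambda>i. coord_deriv A (F i) p v) c)"
proof
  fix c
  show "coord_deriv A (minus_comb Y a F) p v c =
     coord_deriv A Y p v c - lincomb a (\<lambda>i. coord_deriv A (F i) p v) c"
  proof (cases "c \<in> A \<and> p \<in> chart_dom c")
    case True
    let ?u = "chart_map c p"
    have Y: "(local_rep c Y has_derivative frechet_derivative (local_rep c Y) (at ?u)) (at ?u)"
      using assms(1) True by (simp add: frechet_derivative_works[symmetric])
    have F: "(local_rep c (F i) has_derivative frechet_derivative (local_rep c (F i)) (at ?u)) (at ?u)"
      for i using assms(2) True by (simp add: frechet_derivative_works[symmetric])
    have "(local_rep c (minus_comb Y a F) has_derivative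
        (\<lambda>h. frechet_derivative (local_rep c Y) (at ?u) h -
          (\<Sum>i\<in>UNIV. (a $ i) *\<^sub>R frechet_derivative (local_rep c (F i)) (at ?u) h))) (at ?u)"
      unfolding local_rep_minus_comb
      by (intro has_derivative_diff has_derivative_sum has_derivative_scaleR_right Y F)
    from frechet_derivative_at[OF this, symmetric] show ?thesis
      using True by (simp add: coord_deriv_def lincomb_def)
  qed (auto simp: coord_deriv_def lincomb_def)
qed

text \<open>The hypothesis that \<open>X\<close> is of class \<open>C\<^sup>1\<close> ensures that the derivative of its components, as a
  linear map, sends \<open>Z(p) = 0\<close> to \<open>0\<close>; the same holds for the tensor \<open>S\<^sub>X\<close>.\<close>

lemma S_derivation_at_zero:
  assumes M: "differentiable_manifold M A" and X: "X \<in> C1_fields M A"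
    and S: "tensor_field_11 M A (S X)" and p: "p \<in> topspace M" and zero: "Z p = (\<lambda>c. 0)"
  shows "S_derivation A S X Z p = coord_deriv A Z p (X p)"
proof -
  have "S X p (\<lambda>c. 0) = (\<lambda>c. 0)"
    using tensor_field_lincomb[OF M S p, of "\<lambda>_ _. 0" 0] tangent_space_zero[OF M]
    by (simp add: lincomb_def)
  moreover have "coord_deriv A X p (\<lambda>c. 0) = (\<lambda>c. 0)"
    using field_differentiable[OF X] p by (intro coord_deriv_zero)
  ultimately show ?thesis
    by (simp add: S_derivation_def lie_bracket_coord_deriv zero)
qed

lemma S_derivation_minus_comb:
  assumes M: "differentiable_manifold M A" and X: "X \<in> C1_fields M A"
    and S: "tensor_field_11 M A (S X)" and p: "p \<in> topspace M"
    and Y: "Y p \<in> tangent_space A p"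
      "\<And>c. c \<in> A \<Longrightarrow> p \<in> chart_dom c \<Longrightarrow> local_rep c Y differentiable at (chart_map c p)"
    and F: "\<And>i. F i p \<in> tangent_space A p"
      "\<And>c i. c \<in> A \<Longrightarrow> p \<in> chart_dom c \<Longrightarrow> local_rep c (F i) differentiable at (chart_map c p)"
  shows "S_derivation A S X (minus_comb Y a F) p =
     (\<lambda>c. S_derivation A S X Y p c - lincomb a (\<lambda>i. S_derivation A S X (F i) p) c)"
proof -
  have X_diff: "local_rep c X differentiable at (chart_map c p)" if "c \<in> A" "p \<in> chart_dom c" for c
    using field_differentiable[OF X that p] .
  have T: "lincomb a (\<lambda>i. F i p) \<in> tangent_space A p"
    using M F(1) p by (rule lincomb_tangent)
  have "S X p (\<lambda>c. 1 *\<^sub>R Y p c + (-1) *\<^sub>R lincomb a (\<lambda>i. F i p) c) =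
      (\<lambda>c. 1 *\<^sub>R S X p (Y p) c + (-1) *\<^sub>R S X p (lincomb a (\<lambda>i. F i p)) c)"
    using S p Y(1) T by (rule tensor_field_comb)
  hence tensor: "S X p (minus_comb Y a F p) =
      (\<lambda>c. S X p (Y p) c - lincomb a (\<lambda>i. S X p (F i p)) c)"
    using tensor_field_lincomb[where T = "S X" and e = "\<lambda>i. F i p" and a = a, OF M S p F(1)]
    by (simp add: minus_comb_def)
  have "coord_deriv A X p (minus_comb Y a F p) =
      (\<lambda>c. coord_deriv A X p (Y p) c - lincomb a (\<lambda>i. coord_deriv A X p (F i p)) c)"
  proof
    fix c
    show "coord_deriv A X p (minus_comb Y a F p) c =
      coord_deriv A X p (Y p) c - lincomb a (\<lambda>i. coord_deriv A X p (F i p)) c"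
    proof (cases "c \<in> A \<and> p \<in> chart_dom c")
      case True
      hence lin: "linear (frechet_derivative (local_rep c X) (at (chart_map c p)))"
        using X_diff linear_frechet_derivative by blast
      show ?thesis using True
        by (simp add: coord_deriv_def minus_comb_def lincomb_def linear_diff[OF lin]
            linear_sum[OF lin] linear_scale[OF lin])
    qed (auto simp: coord_deriv_def lincomb_def)
  qed
  thus ?thesis
    using tensor coord_deriv_minus_comb[where Y = Y and F = F and a = a and v = "X p", OF Y(2) F(2)]
    by (simp add: S_derivation_def lie_bracket_coord_deriv lincomb_def algebra_simps
        sum_subtractf sum.distrib)
qed

text \<open>If all \<open>D\<^sub>X F\<^sub>i\<close> vanish at \<open>p\<close>, subtracting from \<open>Y\<close> the constant combination of the \<open>F\<^sub>i\<close> that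
  agrees with it at \<open>p\<close> does not change \<open>D\<^sub>X Y\<close> at \<open>p\<close> but makes the field vanish there. The field
  \<open>X\<close> then enters through its value at \<open>p\<close> alone.\<close>

lemma S_derivation_parallel_comb:
  assumes "differentiable_manifold M A" "X \<in> C1_fields M A" "tensor_field_11 M A (S X)"
    and "p \<in> topspace M"
    and "Y p \<in> tangent_space A p"
      "\<And>c. c \<in> A \<Longrightarrow> p \<in> chart_dom c \<Longrightarrow> local_rep c Y differentiable at (chart_map c p)"
    and "\<And>i. F i p \<in> tangent_space A p"
      "\<And>c i. c \<in> A \<Longrightarrow> p \<in> chart_dom c \<Longrightarrow> local_rep c (F i) differentiable at (chart_map c p)"
    and parallel: "\<And>i. S_derivation A S X (F i) p = (\<lambda>c. 0)"
    and at_p: "Y p = lincomb a (\<lambda>i. F i p)"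
  shows "S_derivation A S X Y p = coord_deriv A (minus_comb Y a F) p (X p)"
proof -
  have "S_derivation A S X Y p = S_derivation A S X (minus_comb Y a F) p"
    using S_derivation_minus_comb[where Y = Y and F = F and a = a and S = S and X = X, OF assms(1-8)]
    by (simp add: parallel lincomb_def)
  also have "\<dots> = coord_deriv A (minus_comb Y a F) p (X p)"
    using assms(1-4) by (rule S_derivation_at_zero) (simp add: minus_comb_def at_p)
  finally show ?thesis .
qed

section \<open>The connection coefficients\<close>

text \<open>For each \<open>x\<close> and \<open>j\<close>, the map \<open>v \<mapsto> v\<^sup>k \<partial>\<^sub>k Z\<^sup>i\<close> with \<open>Z = E\<^sub>j - a\<^sup>i F\<^sub>i\<close> depends on the two frames only.
  Its value on \<open>E\<^sub>k(x)\<close> is called \<open>\<tau> x k j\<close> below. This has to be a tangent vector before it can be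
  expanded in the basis \<open>E\<^sub>i(x)\<close>, which is where \<open>coord_deriv_tangent\<close> enters.\<close>

lemma linear_in_every_frame:
  fixes A :: "('a, 'n::finite) chart set"
  assumes M: "differentiable_manifold M A" and U: "U \<subseteq> topspace M"
    and S: "\<And>X. X \<in> C1_fields M A \<Longrightarrow> tensor_field_11 M A (S X)"
    and F: "C1_frame_near M A U F"
    and parallel: "\<And>X x. X \<in> C1_fields M A \<Longrightarrow> x \<in> U \<Longrightarrow>
          component_matrix (S_derivation A S) F X x 0"
    and E: "C1_frame_near M A U E"
  shows "linear_in_frame M A (S_derivation A S) U E"
proof -
  obtain V' where V': "openin M V'" "U \<subseteq> V'" "C1_frame_on A V' F"
    using F unfolding C1_frame_near_def by blast
  obtain V where V: "openin M V" "U \<subseteq> V" "C1_frame_on A V E"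
    using E unfolding C1_frame_near_def by blast
  have E_field: "C1_field_on A V (E j)" for j using V(3) unfolding C1_frame_on_def by blast
  have F_field: "C1_field_on A V' (F j)" for j using V'(3) unfolding C1_frame_on_def by blast
  define Z where "Z x j = minus_comb (E j) (coords F x (E j x)) F" for x j
  define \<tau> where "\<tau> x k j = coord_deriv A (Z x j) x (E k x)" for x k j
  define \<Gamma> :: "'n \<Rightarrow> 'a \<Rightarrow> real ^ 'n ^ 'n"
    where "\<Gamma> k x = (\<chi> i j. coords E x (\<tau> x k j) $ i)" for k x
  have "component_matrix (S_derivation A S) E X x (\<Sum>k\<in>UNIV. (coords E x (X x) $ k) *\<^sub>R \<Gamma> k x)"
    if X: "X \<in> C1_fields M A" and x: "x \<in> U" for X x
    unfolding component_matrix_def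
  proof
    fix j
    have xV: "x \<in> V" "x \<in> V'" "x \<in> topspace M" using x V V' U by auto
    have E_diff: "local_rep c (E i) differentiable at (chart_map c x)"
      if "c \<in> A" "x \<in> chart_dom c" for c i
      using C1_field_differentiable[OF E_field that xV(1)] .
    have F_diff: "local_rep c (F i) differentiable at (chart_map c x)"
      if "c \<in> A" "x \<in> chart_dom c" for c i
      using C1_field_differentiable[OF F_field that xV(2)] .
    have E_tan: "E i q \<in> tangent_space A q" if "q \<in> V" for i q
      using E_field that unfolding C1_field_on_def by blast
    have F_tan: "F i q \<in> tangent_space A q" if "q \<in> V'" for i q
      using F_field that unfolding C1_field_on_def by blast
    have X_tan: "X x \<in> tangent_space A x"
      using X xV(3) unfolding C1_fields_def C1_field_on_def by blast
    have at_x: "E j x = lincomb (coords F x (E j x)) (\<lambda>i. F i x)"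
      using lincomb_coords[OF V'(3) xV(2) E_tan[OF xV(1)]] .
    have Z_diff: "local_rep c (Z x j) differentiable at (chart_map c x)"
      if "c \<in> A" "x \<in> chart_dom c" for c
      unfolding Z_def using E_diff F_diff that by (intro minus_comb_differentiable)
    have Z_tan: "Z x j q \<in> tangent_space A q" if "q \<in> V \<inter> V'" for q
      unfolding Z_def using M openin_subset[OF V(1)] that E_tan F_tan
      by (intro minus_comb_tangent) auto
    have Z_zero: "Z x j x = (\<lambda>c. 0)"
      unfolding Z_def minus_comb_def using at_x by simp
    have \<tau>_tan: "\<tau> x k j \<in> tangent_space A x" for k
      unfolding \<tau>_def using M V(1) V'(1) xV Z_tan Z_diff Z_zero E_tan
      by (intro coord_deriv_tangent[where V = "V \<inter> V'"]) auto
    have "S_derivation A S X (F i) x = (\<lambda>c. 0)" for i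
      using parallel[OF X x] by (simp add: component_matrix_def lincomb_def)
    hence "S_derivation A S X (E j) x = coord_deriv A (Z x j) x (X x)"
      unfolding Z_def
      using M X S[OF X] xV E_tan E_diff F_tan F_diff at_x
      by (intro S_derivation_parallel_comb) auto
    also have "X x = lincomb (coords E x (X x)) (\<lambda>k. E k x)"
      using V(3) xV(1) X_tan by (rule lincomb_coords)
    also have "coord_deriv A (Z x j) x (lincomb (coords E x (X x)) (\<lambda>k. E k x)) =
        lincomb (coords E x (X x)) (\<lambda>k. \<tau> x k j)"
      unfolding \<tau>_def using Z_diff by (rule coord_deriv_lincomb)
    also have "\<dots> = lincomb (coords E x (X x))
        (\<lambda>k. lincomb (coords E x (\<tau> x k j)) (\<lambda>i. E i x))"
      using lincomb_coords[OF V(3) xV(1) \<tau>_tan] by simp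
    also have "\<dots> = lincomb (\<chi> i. \<Sum>k\<in>UNIV. coords E x (X x) $ k * coords E x (\<tau> x k j) $ i)
        (\<lambda>i. E i x)"
      unfolding lincomb_def
      by (simp add: scaleR_sum_right scaleR_sum_left) (rule ext, rule sum.swap)
    finally show "S_derivation A S X (E j) x =
        lincomb (\<chi> i. (\<Sum>k\<in>UNIV. (coords E x (X x) $ k) *\<^sub>R \<Gamma> k x) $ i $ j) (\<lambda>i. E i x)"
      by (simp add: \<Gamma>_def)
  qed
  thus ?thesis
    unfolding linear_in_frame_def by (intro exI[of _ \<Gamma>] ballI)
qed

theorem proposition1:
  fixes M :: "'a topology"
    and A :: "('a, 'n::finite) chart set"
    and D :: "('a, 'n) vfield \<Rightarrow> ('a, 'n) vfield \<Rightarrow> ('a, 'n) vfield"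
    and U :: "'a set"
  assumes "differentiable_manifold M A"
    and "U \<subseteq> topspace M"
    and "is_S_derivation M A D"
    and "\<exists>E'. C1_frame_near M A U E' \<and>
           (\<forall>X\<in>C1_fields M A. \<forall>x\<in>U. component_matrix D E' X x 0)"
  shows "linear_connection_on M A D U"
proof -
  obtain S where S: "\<forall>X\<in>C1_fields M A. tensor_field_11 M A (S X)" and D: "D = S_derivation A S"
    using assms(3) unfolding is_S_derivation_def by (elim exE conjE)
  obtain F where F: "C1_frame_near M A U F"
      "\<forall>X\<in>C1_fields M A. \<forall>x\<in>U. component_matrix D F X x 0"
    using assms(4) by (elim exE conjE)
  have "linear_in_frame M A D U E" if "C1_frame_near M A U E" for E
    unfolding D using assms(1,2) bspec[OF S] F(1) bspec[OF bspec[OF F(2)[unfolded D]]] that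
    by (rule linear_in_every_frame)
  thus ?thesis
    unfolding linear_connection_on_def using F(1) by (intro conjI exI[of _ F] allI impI)
qed

end
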